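(* Let $W\ge 1$ and $\gamma\ge 1$ be real numbers and let $C$ be a gridding kernel, i.e. a complex-valued continuous function on $I_W=[-W,W]$, extended by zero to $\mathbb{R}$. For $x\in[-\tfrac12,\tfrac12)$ such that $\sum_{m\in\mathbb{Z}}|\widehat{C}(x/\gamma+m)|^2\neq 0$, put $$\ell^*(x;C)=1-\frac{|\widehat{C}(x/\gamma)|^2}{\sum_{m\in\mathbb{Z}}|\widehat{C}(x/\gamma+m)|^2}=\frac{\sum_{m\in\mathbb{Z},\,m\neq 0}|\widehat{C}(x/\gamma+m)|^2}{\sum_{m\in\mathbb{Z}}|\widehat{C}(x/\gamma+m)|^2},\qquad h^*(x;C)=\frac{\overline{\widehat{C}(x/\gamma)}}{\sum_{m\in\mathbb{Z}}|\widehat{C}(x/\gamma+m)|^2}.$$ Then, for every such $x$, $\ell^*(x;C)$ is the smallest value of the gridding error function $\ell(x;h,C)$ over all choices of the correcting function $h$, and it is attained when $h(x)=h^*(x;C)$. That is, $\ell(x;h,C)\ge \ell^*(x;C)$ for every complex-valued function $h$ on $[-\tfrac12,\tfrac12)$, and $\ell(x;h,C)=\ell^*(x;C)$ if $h(x)=h^*(x;C)$.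
   Context: The Fourier transform is $\widehat{f}(x)=\int_{\mathbb{R}}f(t)e^{-2\pi i xt}\,dt$. The gridding error function is, for $x\in[-\tfrac12,\tfrac12)$, $$\ell(x;h,C)=\int_0^1\Big|1-h(x)\sum_{k\in\mathbb{Z}\cap[-W,W+1)}C(k-\nu)\,e^{-2\pi i x(k-\nu)/\gamma}\Big|^2\,d\nu,$$ where $C$ is the gridding kernel (zero outside $[-W,W]$), $h$ is the complex-valued gridding correcting function, and $\gamma\ge 1$ is the oversampling factor. *)

theory Defs
  imports "HOL-Analysis.Analysis"
begin

definition fourier :: "(real \<Rightarrow> complex) \<Rightarrow> real \<Rightarrow> complex" where
  "fourier f x = (LBINT t. f t * exp (- 2 * complex_of_real pi * \<i> * complex_of_real x * complex_of_real t))"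

definition gridding_kernel :: "real \<Rightarrow> (real \<Rightarrow> complex) \<Rightarrow> bool" where
  "gridding_kernel W C \<longleftrightarrow> continuous_on {-W..W} C \<and> (\<forall>t. t \<notin> {-W..W} \<longrightarrow> C t = 0)"

text \<open>The correcting function is total here; only its values on \<open>[-1/2, 1/2)\<close> are ever used.\<close>

definition gridding_error ::
    "real \<Rightarrow> real \<Rightarrow> (real \<Rightarrow> complex) \<Rightarrow> (real \<Rightarrow> complex) \<Rightarrow> real \<Rightarrow> real" where
  "gridding_error W \<gamma> h C x =
     (LBINT \<nu>:{0..1}.
        (cmod (1 - h x * (\<Sum>k | - W \<le> real_of_int k \<and> real_of_int k < W + 1.
           C (real_of_int k - \<nu>) *
           exp (- 2 * complex_of_real pi * \<i> * complex_of_real x *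
                complex_of_real (real_of_int k - \<nu>) / complex_of_real \<gamma>))))\<^sup>2)"

text \<open>\<^const>\<open>infsum\<close> is \<open>0\<close> on families that are not summable, so \<open>alias_energy \<gamma> C x \<noteq> 0\<close>
  entails convergence of the series.\<close>

definition alias_energy :: "real \<Rightarrow> (real \<Rightarrow> complex) \<Rightarrow> real \<Rightarrow> real" where
  "alias_energy \<gamma> C x = (\<Sum>\<^sub>\<infinity>m::int. (cmod (fourier C (x / \<gamma> + real_of_int m)))\<^sup>2)"

definition opt_error :: "real \<Rightarrow> (real \<Rightarrow> complex) \<Rightarrow> real \<Rightarrow> real" where
  "opt_error \<gamma> C x = 1 - (cmod (fourier C (x / \<gamma>)))\<^sup>2 / alias_energy \<gamma> C x"

definition opt_correction :: "real \<Rightarrow> (real \<Rightarrow> complex) \<Rightarrow> real \<Rightarrow> complex" where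
  "opt_correction \<gamma> C x = cnj (fourier C (x / \<gamma>)) / complex_of_real (alias_energy \<gamma> C x)"

end

theory Submission
  imports Defs
begin

text \<open>
  For a fixed \<open>x\<close> the gridding error depends on the correcting function only through the one
  complex number \<open>h x\<close>. It is the squared distance, in the mean-square sense over the offset
  \<open>\<nu>\<close>, between the constant \<open>1\<close> and \<open>h x\<close> times a function \<open>g\<close> on \<open>[0, 1]\<close>, so
  the problem is the projection of a vector onto a line. The minimum depends only on the
  inner product of \<open>g\<close> with \<open>1\<close>, the mean of \<open>g\<close>, and on the mean square of \<open>g\<close>.

  Both are read off from the Fourier series of \<open>g\<close>. The function \<open>g\<close> is the periodization of the
  modulated kernel \<open>t \<mapsto> C t * exp (- 2 \<pi> i x t / \<gamma>)\<close>, reflected in \<open>t\<close>. Its \<open>m\<close>-th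
  Fourier coefficient is therefore the Fourier transform of \<open>C\<close> at \<open>x / \<gamma> - m\<close>
  (\<open>fourier_coeff_grid_response\<close>), its mean is the Fourier transform at \<open>x / \<gamma>\<close>, and by the
  Parseval identity its mean square is the alias energy (\<open>has_sum_alias_energy\<close>). Completing the
  square in \<open>h x\<close> (\<open>gridding_error_complete_square\<close>) gives the minimum and the minimizer.

  The analytic content is the Parseval identity (\<open>parseval\<close>). The integer translates of the kernel
  may jump, so \<open>g\<close> is only bounded and Borel; the identity is proved for all such functions, from
  orthonormality of the harmonics and from the density of trigonometric polynomials in the mean square
  (\<open>L2_dense_trig_poly\<close>). Density rests on the Stone-Weierstrass theorem on the circle.
\<close>

section \<open>Bounded Borel functions on the unit interval\<close>

definition harmonic :: "int \<Rightarrow> real \<Rightarrow> complex" where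
  "harmonic m t = cis (2 * pi * of_int m * t)"

abbreviation unit_measure :: "real measure" ("\<U>") where
  "\<U> \<equiv> restrict_space lborel {0..1}"

definition fourier_coeff :: "(real \<Rightarrow> complex) \<Rightarrow> int \<Rightarrow> complex" where
  "fourier_coeff f m = (\<integral>t. f t * cnj (harmonic m t) \<partial>\<U>)"

definition trig_poly :: "(real \<Rightarrow> complex) \<Rightarrow> bool" where
  "trig_poly p \<longleftrightarrow> (\<exists>A c. finite A \<and> p = (\<lambda>t. \<Sum>m\<in>A. c m * harmonic m t))"

text \<open>
  A class of functions that is closed under all the operations below and integrable over
  \<open>[0, 1]\<close>. Boundedness on the whole line, not only on \<open>[0, 1]\<close>, makes the class
  invariant under reflection and translation. Continuity would be too much to ask: a gridding kernel
  may jump to zero at \<open>\<plusminus>W\<close>.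
\<close>
definition bounded_borel :: "(real \<Rightarrow> 'a::euclidean_space) \<Rightarrow> bool" where
  "bounded_borel f \<longleftrightarrow> f \<in> borel_measurable borel \<and> (\<exists>B>0. \<forall>t. norm (f t) \<le> B)"

lemma bounded_borelI:
  assumes "f \<in> borel_measurable borel" "\<And>t. norm (f t) \<le> B"
  shows "bounded_borel f"
proof -
  have "\<forall>t. norm (f t) \<le> max 1 B"
    using assms(2) by (auto intro: max.coboundedI2)
  then show ?thesis
    unfolding bounded_borel_def using assms(1) by (intro conjI exI[of _ "max 1 B"]) auto
qed

lemma set_integral_unit_interval:
  fixes f :: "real \<Rightarrow> 'a::euclidean_space"
  shows "(LBINT t:{0..1}. f t) = (\<integral>t. f t \<partial>\<U>)"
  by (simp add: integral_restrict_space set_lebesgue_integral_def)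

lemma finite_measure_unit: "finite_measure \<U>"
  by (rule finite_measureI) (simp add: emeasure_restrict_space space_restrict_space)

lemma measure_unit [simp]: "measure \<U> {0..1} = 1"
  by (simp add: measure_restrict_space)

lemma integrable_bounded_borel:
  assumes "bounded_borel f"
  shows "integrable \<U> f"
proof -
  obtain B where "f \<in> borel_measurable borel" "\<And>t. norm (f t) \<le> B"
    using assms unfolding bounded_borel_def by blast
  then show ?thesis
    by (intro finite_measure.integrable_const_bound[OF finite_measure_unit, of _ B])
       (auto intro: measurable_restrict_space1)
qed

lemma bounded_borel_const: "bounded_borel (\<lambda>t. c)"
  by (rule bounded_borelI[of _ "norm c"]) auto

lemma bounded_borel_add:
  assumes "bounded_borel f" "bounded_borel g"
  shows "bounded_borel (\<lambda>t. f t + g t)"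
proof -
  obtain B where B: "f \<in> borel_measurable borel" "\<And>t. norm (f t) \<le> B"
    using assms(1) unfolding bounded_borel_def by blast
  obtain D where D: "g \<in> borel_measurable borel" "\<And>t. norm (g t) \<le> D"
    using assms(2) unfolding bounded_borel_def by blast
  have "(\<lambda>t. f t + g t) \<in> borel_measurable borel"
    using B(1) D(1) by simp
  moreover have "norm (f t + g t) \<le> B + D" for t
    using B(2) D(2) by (rule norm_triangle_mono)
  ultimately show ?thesis by (rule bounded_borelI)
qed

lemma bounded_borel_mult:
  fixes f g :: "real \<Rightarrow> complex"
  assumes "bounded_borel f" "bounded_borel g"
  shows "bounded_borel (\<lambda>t. f t * g t)"
proof -
  obtain B where B: "0 < B" "f \<in> borel_measurable borel" "\<And>t. norm (f t) \<le> B"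
    using assms(1) unfolding bounded_borel_def by blast
  obtain D where D: "g \<in> borel_measurable borel" "\<And>t. norm (g t) \<le> D"
    using assms(2) unfolding bounded_borel_def by blast
  have "(\<lambda>t. f t * g t) \<in> borel_measurable borel"
    using B(2) D(1) by simp
  moreover have "norm (f t * g t) \<le> B * D" for t
    using B(1) B(3)[of t] D(2)[of t] by (simp add: norm_mult mult_mono)
  ultimately show ?thesis by (rule bounded_borelI)
qed

lemma bounded_borel_linear:
  assumes "bounded_linear T" "bounded_borel f"
  shows "bounded_borel (\<lambda>t. T (f t))"
proof -
  obtain B where B: "f \<in> borel_measurable borel" "\<And>t. norm (f t) \<le> B"
    using assms(2) unfolding bounded_borel_def by blast
  obtain K where K: "0 \<le> K" "\<And>x. norm (T x) \<le> norm x * K"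
    using assms(1) bounded_linear.nonneg_bounded by blast
  have "T \<in> borel_measurable borel"
    using assms(1) by (intro borel_measurable_continuous_onI linear_continuous_on)
  then have "(\<lambda>t. T (f t)) \<in> borel_measurable borel"
    using B(1) by simp
  moreover have "norm (T (f t)) \<le> B * K" for t
    using K(2)[of "f t"] mult_right_mono[OF B(2)[of t] K(1)] by linarith
  ultimately show ?thesis by (rule bounded_borelI)
qed

lemmas bounded_borel_cnj = bounded_borel_linear[OF bounded_linear_cnj]
lemmas bounded_borel_Re = bounded_borel_linear[OF bounded_linear_Re]

lemma bounded_borel_uminus: "bounded_borel f \<Longrightarrow> bounded_borel (\<lambda>t. - f t)"
  by (rule bounded_borel_linear[OF bounded_linear_minus[OF bounded_linear_ident]])

lemma bounded_borel_diff:
  "bounded_borel f \<Longrightarrow> bounded_borel g \<Longrightarrow> bounded_borel (\<lambda>t. f t - g t)"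
  using bounded_borel_add[OF _ bounded_borel_uminus[of g], of f] by simp

lemma bounded_borel_sum:
  "(\<And>i. i \<in> A \<Longrightarrow> bounded_borel (f i)) \<Longrightarrow> bounded_borel (\<lambda>t. \<Sum>i\<in>A. f i t)"
  by (induction A rule: infinite_finite_induct)
     (simp_all add: bounded_borel_add bounded_borel_const)

lemma bounded_borel_harmonic: "bounded_borel (harmonic m)"
proof (rule bounded_borelI)
  have "continuous_on UNIV (\<lambda>t. exp (\<i> * of_real (2 * pi * of_int m * t)))"
    by (intro continuous_intros)
  then show "harmonic m \<in> borel_measurable borel"
    unfolding harmonic_def cis_conv_exp by (rule borel_measurable_continuous_onI)
  show "norm (harmonic m t) \<le> 1" for t
    by (simp add: harmonic_def)
qed

lemma bounded_borel_cmod_sq: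
  assumes "bounded_borel f"
  shows "bounded_borel (\<lambda>t. (cmod (f t))\<^sup>2)"
proof -
  have "(cmod z)\<^sup>2 = Re (z * cnj z)" for z
    by (simp add: complex_mult_cnj cmod_power2)
  then show ?thesis
    by (simp only:) (intro bounded_borel_Re bounded_borel_mult bounded_borel_cnj assms)
qed

lemmas bounded_borel_intros =
  bounded_borel_const bounded_borel_add bounded_borel_diff bounded_borel_mult bounded_borel_cnj
  bounded_borel_Re bounded_borel_sum bounded_borel_harmonic bounded_borel_cmod_sq

section \<open>Trigonometric polynomials\<close>

lemma harmonic_0 [simp]: "harmonic 0 t = 1"
  by (simp add: harmonic_def)

lemma harmonic_mult: "harmonic m t * harmonic n t = harmonic (m + n) t"
  by (simp add: harmonic_def cis_mult algebra_simps)

lemma cnj_harmonic: "cnj (harmonic m t) = harmonic (- m) t"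
  by (simp add: harmonic_def cis_cnj)

text \<open>
  The harmonics cannot see an integer shift; this is what turns the shifts of the periodization below
  into one integral over the line.
\<close>

lemma harmonic_of_int: "harmonic m (of_int k) = 1"
proof -
  have "cis (2 * pi * of_int (m * k)) = 1"
    by (intro cis_multiple_2pi) auto
  then show ?thesis by (simp add: harmonic_def mult.assoc)
qed

lemma harmonic_diff: "harmonic m (s - t) = harmonic m s * cnj (harmonic m t)"
  by (simp add: harmonic_def cis_cnj cis_mult algebra_simps)

lemma integral_harmonic: "(\<integral>t. harmonic m t \<partial>\<U>) = (if m = 0 then 1 else 0)"
proof (cases "m = 0")
  case False
  define w where "w = 2 * complex_of_real pi * \<i> * of_int m"
  have w: "w \<noteq> 0" using False by (simp add: w_def)
  have eq: "harmonic m t = exp (w * of_real t)" for t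
    by (simp add: harmonic_def cis_conv_exp w_def mult_ac)
  have "integral\<^sup>L lborel (\<lambda>x. indicator {0..1} x *\<^sub>R harmonic m x)
      = exp (w * of_real 1) / w - exp (w * of_real 0) / w"
  proof (rule integral_FTC_atLeastAtMost)
    fix t :: real
    have "((\<lambda>z. exp (w * z) / w) has_field_derivative exp (w * of_real t)) (at (of_real t))"
      using w by (auto intro!: derivative_eq_intros)
    then have "((\<lambda>t. exp (w * of_real t) / w) has_vector_derivative exp (w * of_real t)) (at t within {0..1})"
      by (rule has_vector_derivative_real_field)
    then show "((\<lambda>t. exp (w * of_real t) / w) has_vector_derivative harmonic m t) (at t within {0..1})"
      by (simp add: eq)
  qed (auto simp: eq intro!: continuous_intros)
  also have "\<dots> = 0"
    using harmonic_of_int[of m 1] by (simp add: eq)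
  finally show ?thesis using False by (simp add: integral_restrict_space)
qed simp

lemma trig_poly_harmonic: "trig_poly (\<lambda>t. c * harmonic m t)"
  unfolding trig_poly_def by (rule exI[of _ "{m}"], rule exI[of _ "\<lambda>_. c"]) simp

lemma trig_poly_const: "trig_poly (\<lambda>t. c)"
  using trig_poly_harmonic[of c 0] by simp

lemma trig_poly_add:
  assumes "trig_poly p" "trig_poly q"
  shows "trig_poly (\<lambda>t. p t + q t)"
proof -
  obtain A c where A: "finite A" "p = (\<lambda>t. \<Sum>m\<in>A. c m * harmonic m t)"
    using assms(1) unfolding trig_poly_def by blast
  obtain B d where B: "finite B" "q = (\<lambda>t. \<Sum>m\<in>B. d m * harmonic m t)"
    using assms(2) unfolding trig_poly_def by blast
  have "p t = (\<Sum>m\<in>A \<union> B. (if m \<in> A then c m else 0) * harmonic m t)" for t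
    unfolding A(2) using A(1) B(1) by (intro sum.mono_neutral_cong_left) auto
  moreover have "q t = (\<Sum>m\<in>A \<union> B. (if m \<in> B then d m else 0) * harmonic m t)" for t
    unfolding B(2) using A(1) B(1) by (intro sum.mono_neutral_cong_left) auto
  ultimately have "(\<lambda>t. p t + q t) = (\<lambda>t. \<Sum>m\<in>A \<union> B.
      ((if m \<in> A then c m else 0) + (if m \<in> B then d m else 0)) * harmonic m t)"
    by (simp add: sum.distrib distrib_right)
  moreover have "finite (A \<union> B)" using A(1) B(1) by simp
  ultimately show ?thesis
    unfolding trig_poly_def by (intro exI[of _ "A \<union> B"] exI conjI) assumption+
qed

lemma trig_poly_sum:
  "(\<And>i. i \<in> A \<Longrightarrow> trig_poly (p i)) \<Longrightarrow> trig_poly (\<lambda>t. \<Sum>i\<in>A. p i t)"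
  by (induction A rule: infinite_finite_induct) (simp_all add: trig_poly_add trig_poly_const)

lemma trig_poly_mult:
  assumes "trig_poly p" "trig_poly q"
  shows "trig_poly (\<lambda>t. p t * q t)"
proof -
  obtain A c where A: "p = (\<lambda>t. \<Sum>m\<in>A. c m * harmonic m t)"
    using assms(1) unfolding trig_poly_def by blast
  obtain B d where B: "q = (\<lambda>t. \<Sum>n\<in>B. d n * harmonic n t)"
    using assms(2) unfolding trig_poly_def by blast
  have "p t * q t = (\<Sum>m\<in>A. \<Sum>n\<in>B. (c m * d n) * harmonic (m + n) t)" for t
    unfolding A B by (simp add: sum_product harmonic_mult[symmetric] mult_ac)
  then show ?thesis
    by (simp add: trig_poly_sum trig_poly_harmonic)
qed

text \<open>
  On the circle, \<open>Re z\<close> and \<open>Im z\<close> are combinations of \<open>z\<close> and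
  \<open>cnj z\<close>, that is, of the harmonics \<open>1\<close> and \<open>-1\<close>. So every real-linear form,
  and hence every polynomial in the real coordinates, becomes a trigonometric polynomial.
\<close>

lemma trig_poly_real_polynomial:
  assumes "real_polynomial_function (p :: complex \<Rightarrow> real)"
  shows "trig_poly (\<lambda>t. of_real (p (harmonic 1 t)))"
  using assms
proof induction
  case (linear T)
  interpret bounded_linear T by fact
  define a b where "a = (of_real (T 1) - \<i> * of_real (T \<i>)) / 2"
    and "b = (of_real (T 1) + \<i> * of_real (T \<i>)) / 2"
  have "of_real (T z) = a * z + b * cnj z" for z
  proof -
    have "T z = T (Re z *\<^sub>R 1 + Im z *\<^sub>R \<i>)"
      by (metis complex_eq mult.commute scaleR_conv_of_real mult.right_neutral)
    then have "T z = Re z * T 1 + Im z * T \<i>"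
      by (simp only: add scaleR real_scaleR_def)
    then show ?thesis by (simp add: a_def b_def complex_eq_iff field_simps)
  qed
  then show ?case
    by (simp add: cnj_harmonic trig_poly_add trig_poly_harmonic)
next
  case (const c)
  show ?case by (rule trig_poly_const)
next
  case (add f g)
  then show ?case using trig_poly_add by simp
next
  case (mult f g)
  then show ?case using trig_poly_mult by simp
qed

lemma trig_poly_polynomial:
  assumes "polynomial_function (p :: complex \<Rightarrow> complex)"
  shows "trig_poly (\<lambda>t. p (harmonic 1 t))"
proof -
  have "trig_poly (\<lambda>t. of_real (Re (p (harmonic 1 t))) + \<i> * of_real (Im (p (harmonic 1 t))))"
    using assms bounded_linear_Re bounded_linear_Im unfolding polynomial_function_def o_def
    by (intro trig_poly_add trig_poly_mult trig_poly_const trig_poly_real_polynomial) blast+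
  then show ?thesis by (simp flip: complex_eq)
qed

text \<open>
  A closed loop on \<open>[0, 1]\<close> is the same as a continuous function on the circle, and there the
  Stone-Weierstrass theorem supplies polynomials in the real coordinates. Matching endpoint values are
  essential: they make the loop continuous across the point \<open>1\<close> of the circle.
\<close>

lemma uniform_trig_poly_approx:
  fixes q :: "real \<Rightarrow> complex"
  assumes q: "continuous_on {0..1} q" "q 0 = q 1" and e: "0 < e"
  obtains p where "trig_poly p" "\<And>t. t \<in> {0..1} \<Longrightarrow> cmod (q t - p t) < e"
proof -
  let ?F = "q \<circ> (\<lambda>z. Arg2pi z / (2 * pi))"
  \<comment> \<open>The trivial homotopy is used only to transfer continuity from the interval to the circle.\<close>
  have "homotopic_loops UNIV q q"
    using q by (simp add: homotopic_loops_refl path_def pathstart_def pathfinish_def)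
  then have "continuous_on (sphere 0 1) ?F"
    by (rule homotopic_loops_imp_homotopic_circlemaps
        [THEN homotopic_with_imp_continuous, THEN conjunct1])
  from Stone_Weierstrass_polynomial_function[OF compact_sphere this e]
  obtain P where P: "polynomial_function P" "\<And>z. z \<in> sphere 0 1 \<Longrightarrow> cmod (?F z - P z) < e"
    by auto
  have "?F (harmonic 1 t) = q t" if t: "t \<in> {0..1}" for t
  proof (cases "t = 1")
    case True
    then show ?thesis using q(2) harmonic_of_int[of 1 1] Arg2pi_of_real[of 1] by simp
  next
    case False
    have "Arg2pi (harmonic 1 t) = 2 * pi * t"
      by (rule Arg2pi_unique[of 1]) (use t False in \<open>auto simp: harmonic_def cis_conv_exp\<close>)
    then show ?thesis by simp
  qed
  moreover have "harmonic 1 t \<in> sphere 0 1" for t by (simp add: harmonic_def)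
  ultimately have "cmod (q t - P (harmonic 1 t)) < e" if "t \<in> {0..1}" for t
    using P(2)[of "harmonic 1 t"] that by simp
  then show ?thesis
    by (rule that[OF trig_poly_polynomial[OF P(1)]])
qed

section \<open>Density in the mean square\<close>

text \<open>
  A measurable function is an almost everywhere limit of continuous functions. Projecting the values of
  these onto a disc that contains the range of \<open>f\<close> keeps them bounded and does not disturb the
  limit, and a cutoff that vanishes at \<open>0\<close> and \<open>1\<close> closes them up to loops at the price of
  two points of \<open>[0, 1]\<close>. Bounded convergence then gives convergence in the mean square.
\<close>

lemma L2_approx_by_continuous_loop:
  fixes f :: "real \<Rightarrow> complex"
  assumes f: "bounded_borel f" and e: "0 < e"
  obtains q where "bounded_borel q" "continuous_on UNIV q" "q 0 = q 1"
    "(\<integral>t. (cmod (f t - q t))\<^sup>2 \<partial>\<U>) < e"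
proof -
  obtain B where B: "0 < B" "f \<in> borel_measurable borel" "\<And>t. cmod (f t) \<le> B"
    using f unfolding bounded_borel_def by blast
  have "f \<in> borel_measurable lebesgue"
    using B(2) by (simp add: measurable_completion)
  then have "f measurable_on UNIV"
    by (simp add: lebesgue_measurable_imp_measurable_on)
  then obtain N g where N: "negligible N" and g: "\<And>n. continuous_on UNIV (g n)"
    and lim: "\<And>t. t \<notin> N \<Longrightarrow> (\<lambda>n. g n t) \<longlonglongrightarrow> f t"
    unfolding measurable_on_def by auto
  define clip where "clip = closest_point (cball (0::complex) B)"
  \<comment> \<open>Tends to \<open>1\<close> inside the interval; the exponent \<open>Suc n\<close> makes it vanish at both
    endpoints for \<open>n = 0\<close> as well, and the minimum keeps it bounded on the whole line.\<close>
  define cut where "cut n t = 1 - (min 1 \<bar>2 * t - 1\<bar>) ^ Suc n" for n :: nat and t :: real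
  define q where "q n t = of_real (cut n t) * clip (g n t)" for n t
  have clip_cont: "continuous_on UNIV clip"
    unfolding clip_def using B(1) by (intro continuous_on_closest_point) auto
  have clip_le: "cmod (clip z) \<le> B" for z
    using closest_point_in_set[of "cball 0 B" z] B(1) by (auto simp: clip_def)
  have clip_f: "clip (f t) = f t" for t
    unfolding clip_def using B(3) by (intro closest_point_self) auto
  have cut01: "\<bar>cut n t\<bar> \<le> 1" for n t
    using power_le_one[of "min 1 \<bar>2 * t - 1\<bar>" "Suc n"] zero_le_power[of "min 1 \<bar>2 * t - 1\<bar>" "Suc n"]
    unfolding cut_def by linarith
  have q_cont: "continuous_on UNIV (q n)" for n
    unfolding q_def cut_def
    by (intro continuous_intros continuous_on_compose2[OF clip_cont g]) auto
  have q_le: "cmod (q n t) \<le> B" for n t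
    using mult_mono[OF cut01[of n t] clip_le[of "g n t"]] by (simp add: q_def norm_mult)
  have q_bb: "bounded_borel (q n)" for n
    using q_le by (rule bounded_borelI[OF borel_measurable_continuous_onI[OF q_cont]])
  have q_lim: "(\<lambda>n. q n t) \<longlonglongrightarrow> f t" if "t \<notin> N" "0 < t" "t < 1" for t
  proof -
    have "(\<lambda>n. min 1 \<bar>2 * t - 1\<bar> ^ Suc n) \<longlonglongrightarrow> 0"
      using that by (intro LIMSEQ_Suc LIMSEQ_power_zero) auto
    then have "(\<lambda>n. cut n t) \<longlonglongrightarrow> 1"
      unfolding cut_def using tendsto_diff[OF tendsto_const[of 1]] by fastforce
    moreover have "isCont clip (f t)"
      using clip_cont by (simp add: continuous_on_eq_continuous_at)
    then have "(\<lambda>n. clip (g n t)) \<longlonglongrightarrow> clip (f t)"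
      using lim[OF that(1)] by (rule isCont_tendsto_compose)
    ultimately have "(\<lambda>n. q n t) \<longlonglongrightarrow> of_real 1 * clip (f t)"
      unfolding q_def by (intro tendsto_mult tendsto_of_real)
    then show ?thesis by (simp add: clip_f)
  qed
  have "AE t in lebesgue. t \<notin> N"
    using N by (simp add: negligible_iff_null_sets AE_not_in)
  then have "AE t in lborel. t \<notin> N"
    by (simp add: AE_completion_iff)
  then have "AE t in lborel. t \<in> {0..1} \<longrightarrow> (\<lambda>n. (cmod (f t - q n t))\<^sup>2) \<longlonglongrightarrow> 0"
    using AE_lborel_singleton[of 0] AE_lborel_singleton[of 1]
  proof eventually_elim
    case (elim t)
    show ?case
    proof
      assume "t \<in> {0..1}"
      with elim have "(\<lambda>n. q n t) \<longlonglongrightarrow> f t" by (intro q_lim) auto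
      then have "(\<lambda>n. (cmod (f t - q n t))\<^sup>2) \<longlonglongrightarrow> (cmod (f t - f t))\<^sup>2"
        by (intro tendsto_intros)
      then show "(\<lambda>n. (cmod (f t - q n t))\<^sup>2) \<longlonglongrightarrow> 0" by simp
    qed
  qed
  then have lim0: "AE t in \<U>. (\<lambda>n. (cmod (f t - q n t))\<^sup>2) \<longlonglongrightarrow> 0"
    by (simp add: AE_restrict_space_iff)
  have int: "integrable \<U> (\<lambda>t. (cmod (f t - q n t))\<^sup>2)" for n
    by (intro integrable_bounded_borel bounded_borel_intros f q_bb)
  have "(\<lambda>n. \<integral>t. (cmod (f t - q n t))\<^sup>2 \<partial>\<U>) \<longlonglongrightarrow> (\<integral>t. 0 \<partial>\<U>)"
  proof (rule integral_dominated_convergence[where w = "\<lambda>_. (2 * B)\<^sup>2", OF _ _ _ lim0])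
    show "integrable \<U> (\<lambda>_. (2 * B)\<^sup>2)"
      by (intro integrable_bounded_borel bounded_borel_const)
    fix n
    show "(\<lambda>t. (cmod (f t - q n t))\<^sup>2) \<in> borel_measurable \<U>"
      using int by (rule borel_measurable_integrable)
    have "cmod (f t - q n t) \<le> 2 * B" for t
      using norm_triangle_ineq4[of "f t" "q n t"] B(3)[of t] q_le[of n t] by linarith
    then have "norm ((cmod (f t - q n t))\<^sup>2) \<le> (2 * B)\<^sup>2" for t
      unfolding real_norm_def abs_power2 by (intro power_mono) auto
    then show "AE t in \<U>. norm ((cmod (f t - q n t))\<^sup>2) \<le> (2 * B)\<^sup>2"
      by (intro AE_I2)
  qed simp
  then have "\<forall>\<^sub>F n in sequentially. (\<integral>t. (cmod (f t - q n t))\<^sup>2 \<partial>\<U>) < e"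
    using e by (intro order_tendstoD(2)) auto
  then obtain n where "(\<integral>t. (cmod (f t - q n t))\<^sup>2 \<partial>\<U>) < e"
    using eventually_happens trivial_limit_sequentially by blast
  moreover have "q n 0 = q n 1"
    by (simp add: q_def cut_def)
  ultimately show ?thesis
    using that q_bb q_cont by blast
qed

lemma bounded_borel_trig_poly: "trig_poly p \<Longrightarrow> bounded_borel p"
  unfolding trig_poly_def
  by (elim exE conjE, simp only:) (intro bounded_borel_intros)

lemma L2_dense_trig_poly:
  assumes f: "bounded_borel f" and e: "0 < e"
  obtains p where "trig_poly p" "(\<integral>t. (cmod (f t - p t))\<^sup>2 \<partial>\<U>) < e"
proof -
  obtain q where q: "bounded_borel q" "continuous_on UNIV q" "q 0 = q 1"
    "(\<integral>t. (cmod (f t - q t))\<^sup>2 \<partial>\<U>) < e / 4"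
    using L2_approx_by_continuous_loop[OF f, of "e / 4"] e by auto
  have "continuous_on {0..1} q" using q(2) continuous_on_subset by blast
  then obtain p where p: "trig_poly p" "\<And>t. t \<in> {0..1} \<Longrightarrow> cmod (q t - p t) < sqrt (e / 4)"
    using uniform_trig_poly_approx[of q "sqrt (e / 4)"] q(3) e by auto
  note bb = f q(1) bounded_borel_trig_poly[OF p(1)]
  have "(\<integral>t. (cmod (f t - p t))\<^sup>2 \<partial>\<U>) \<le> (\<integral>t. 2 * (cmod (f t - q t))\<^sup>2 + e / 2 \<partial>\<U>)"
  proof (rule integral_mono)
    show "integrable \<U> (\<lambda>t. (cmod (f t - p t))\<^sup>2)"
      by (intro integrable_bounded_borel bounded_borel_intros bb)
    show "integrable \<U> (\<lambda>t. 2 * (cmod (f t - q t))\<^sup>2 + e / 2)"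
      by (intro Bochner_Integration.integrable_add integrable_mult_right integrable_bounded_borel
          bounded_borel_intros bb)
    fix t assume "t \<in> space \<U>"
    then have "cmod (q t - p t) < sqrt (e / 4)"
      using p(2) by (simp add: space_restrict_space)
    then have "(cmod (q t - p t))\<^sup>2 \<le> (sqrt (e / 4))\<^sup>2"
      by (intro power_mono) auto
    then have *: "(cmod (q t - p t))\<^sup>2 \<le> e / 4"
      using e by simp
    have "cmod (f t - p t) \<le> cmod (f t - q t) + cmod (q t - p t)"
      using norm_triangle_ineq[of "f t - q t" "q t - p t"] by simp
    then have "(cmod (f t - p t))\<^sup>2 \<le> (cmod (f t - q t) + cmod (q t - p t))\<^sup>2"
      by (intro power_mono) auto
    also have "\<dots> \<le> 2 * (cmod (f t - q t))\<^sup>2 + 2 * (cmod (q t - p t))\<^sup>2"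
      using zero_le_power2[of "cmod (f t - q t) - cmod (q t - p t)"]
      by (simp add: power2_sum power2_diff)
    finally show "(cmod (f t - p t))\<^sup>2 \<le> 2 * (cmod (f t - q t))\<^sup>2 + e / 2"
      using * by simp
  qed
  also have "\<dots> = 2 * (\<integral>t. (cmod (f t - q t))\<^sup>2 \<partial>\<U>) + e / 2"
  proof (subst Bochner_Integration.integral_add)
    have "integrable \<U> (\<lambda>t. (cmod (f t - q t))\<^sup>2)"
      by (intro integrable_bounded_borel bounded_borel_intros bb)
    then show "integrable \<U> (\<lambda>t. 2 * (cmod (f t - q t))\<^sup>2)"
      by (rule integrable_mult_right)
    show "integrable \<U> (\<lambda>t. e / 2)"
      by (intro integrable_bounded_borel bounded_borel_const)
  qed simp
  also have "\<dots> < e" using q(4) by simp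
  finally show ?thesis using that p(1) by blast
qed

section \<open>Parseval identity\<close>

lemma integral_mult_cnj_trig_poly:
  assumes f: "bounded_borel f" and A: "finite A"
  shows "(\<integral>t. f t * cnj (\<Sum>m\<in>A. d m * harmonic m t) \<partial>\<U>) = (\<Sum>m\<in>A. cnj (d m) * fourier_coeff f m)"
proof -
  have "(\<integral>t. f t * cnj (\<Sum>m\<in>A. d m * harmonic m t) \<partial>\<U>)
      = (\<integral>t. (\<Sum>m\<in>A. cnj (d m) * (f t * cnj (harmonic m t))) \<partial>\<U>)"
    by (simp add: sum_distrib_left mult_ac)
  also have "\<dots> = (\<Sum>m\<in>A. \<integral>t. cnj (d m) * (f t * cnj (harmonic m t)) \<partial>\<U>)"
    by (intro Bochner_Integration.integral_sum integrable_bounded_borel bounded_borel_intros f)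
  also have "\<dots> = (\<Sum>m\<in>A. cnj (d m) * fourier_coeff f m)"
    by (simp add: fourier_coeff_def)
  finally show ?thesis .
qed

lemma fourier_coeff_harmonic: "fourier_coeff (harmonic n) m = (if m = n then 1 else 0)"
  unfolding fourier_coeff_def cnj_harmonic harmonic_mult by (simp add: integral_harmonic)

lemma fourier_coeff_trig_poly:
  assumes A: "finite A"
  shows "fourier_coeff (\<lambda>t. \<Sum>n\<in>A. d n * harmonic n t) m = (if m \<in> A then d m else 0)"
proof -
  have "fourier_coeff (\<lambda>t. \<Sum>n\<in>A. d n * harmonic n t) m
      = (\<integral>t. (\<Sum>n\<in>A. d n * (harmonic n t * cnj (harmonic m t))) \<partial>\<U>)"
    by (simp add: fourier_coeff_def sum_distrib_right mult.assoc)
  also have "\<dots> = (\<Sum>n\<in>A. \<integral>t. d n * (harmonic n t * cnj (harmonic m t)) \<partial>\<U>)"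
    by (intro Bochner_Integration.integral_sum integrable_bounded_borel bounded_borel_intros)
  also have "\<dots> = (\<Sum>n\<in>A. d n * fourier_coeff (harmonic n) m)"
    by (simp add: fourier_coeff_def)
  also have "\<dots> = (\<Sum>n\<in>A. if m = n then d n else 0)"
    by (intro sum.cong) (auto simp: fourier_coeff_harmonic)
  also have "\<dots> = (if m \<in> A then d m else 0)"
    using A by simp
  finally show ?thesis .
qed

lemma integral_norm_sq_trig_poly:
  assumes A: "finite A"
  shows "(\<integral>t. (cmod (\<Sum>m\<in>A. d m * harmonic m t))\<^sup>2 \<partial>\<U>) = (\<Sum>m\<in>A. (cmod (d m))\<^sup>2)"
proof -
  let ?p = "\<lambda>t. \<Sum>m\<in>A. d m * harmonic m t"
  have "complex_of_real (\<integral>t. (cmod (?p t))\<^sup>2 \<partial>\<U>) = (\<integral>t. ?p t * cnj (?p t) \<partial>\<U>)"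
    by (simp only: integral_complex_of_real[symmetric] complex_norm_square)
  also have "\<dots> = (\<Sum>m\<in>A. cnj (d m) * fourier_coeff ?p m)"
    by (intro integral_mult_cnj_trig_poly A bounded_borel_intros)
  also have "\<dots> = of_real (\<Sum>m\<in>A. (cmod (d m))\<^sup>2)"
    by (simp add: fourier_coeff_trig_poly A complex_norm_square mult.commute del: of_real_power)
  finally show ?thesis by (simp only: of_real_eq_iff)
qed

lemma cmod_diff_sq: "(cmod (a - b))\<^sup>2 = (cmod a)\<^sup>2 - 2 * Re (a * cnj b) + (cmod b)\<^sup>2"
  unfolding cmod_power2 by (simp add: power2_eq_square algebra_simps)

lemma integral_norm_diff_sq:
  assumes f: "bounded_borel f" and g: "bounded_borel g"
  shows "(\<integral>t. (cmod (f t - g t))\<^sup>2 \<partial>\<U>) =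
    (\<integral>t. (cmod (f t))\<^sup>2 \<partial>\<U>) - 2 * Re (\<integral>t. f t * cnj (g t) \<partial>\<U>) + (\<integral>t. (cmod (g t))\<^sup>2 \<partial>\<U>)"
proof -
  have i1: "integrable \<U> (\<lambda>t. (cmod (f t))\<^sup>2)"
    and i2: "integrable \<U> (\<lambda>t. (cmod (g t))\<^sup>2)"
    and i3: "integrable \<U> (\<lambda>t. f t * cnj (g t))"
    by (intro integrable_bounded_borel bounded_borel_intros f g)+
  have i4: "integrable \<U> (\<lambda>t. 2 * Re (f t * cnj (g t)))"
    using i3 by (intro integrable_mult_right integrable_Re)
  show ?thesis
    unfolding cmod_diff_sq
    by (simp only: Bochner_Integration.integral_add[OF Bochner_Integration.integrable_diff[OF i1 i4] i2]
        Bochner_Integration.integral_diff[OF i1 i4] integral_mult_right_zero integral_Re[OF i3])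
qed

text \<open>
  The Pythagorean theorem for the subspace spanned by the harmonics in \<open>A\<close>. With
  \<open>d = fourier_coeff f\<close> it is the Bessel identity; for general \<open>d\<close> it shows that the Fourier
  partial sum is the best approximation.
\<close>

lemma integral_norm_diff_trig_poly:
  assumes f: "bounded_borel f" and A: "finite A"
  shows "(\<integral>t. (cmod (f t - (\<Sum>m\<in>A. d m * harmonic m t)))\<^sup>2 \<partial>\<U>) =
    (\<integral>t. (cmod (f t))\<^sup>2 \<partial>\<U>) - (\<Sum>m\<in>A. (cmod (fourier_coeff f m))\<^sup>2)
      + (\<Sum>m\<in>A. (cmod (fourier_coeff f m - d m))\<^sup>2)"
proof -
  have "(\<integral>t. (cmod (f t - (\<Sum>m\<in>A. d m * harmonic m t)))\<^sup>2 \<partial>\<U>) =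
     (\<integral>t. (cmod (f t))\<^sup>2 \<partial>\<U>) - 2 * Re (\<Sum>m\<in>A. cnj (d m) * fourier_coeff f m)
       + (\<Sum>m\<in>A. (cmod (d m))\<^sup>2)"
    unfolding integral_mult_cnj_trig_poly[OF f A, symmetric] integral_norm_sq_trig_poly[OF A, symmetric]
    by (intro integral_norm_diff_sq f bounded_borel_intros)
  then show ?thesis
    by (simp add: cmod_diff_sq sum.distrib sum_subtractf sum_distrib_left mult.commute)
qed

text \<open>
  Bessel's inequality bounds all finite sums by the integral. Conversely, if some trigonometric
  polynomial with frequencies in \<open>A\<close> has mean-square error below \<open>e\<close>, then the sum over \<open>A\<close>,
  and so over every larger finite set, misses the integral by less than \<open>e\<close>.
\<close>

theorem parseval:
  assumes f: "bounded_borel f"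
  shows "((\<lambda>m. (cmod (fourier_coeff f m))\<^sup>2) has_sum (\<integral>t. (cmod (f t))\<^sup>2 \<partial>\<U>)) UNIV"
  unfolding has_sum_def
proof (rule tendstoI)
  let ?I = "\<integral>t. (cmod (f t))\<^sup>2 \<partial>\<U>" and ?c = "fourier_coeff f"
  fix e :: real assume "0 < e"
  then obtain p where "trig_poly p" and p: "(\<integral>t. (cmod (f t - p t))\<^sup>2 \<partial>\<U>) < e"
    using L2_dense_trig_poly[OF f] by blast
  then obtain A d where A: "finite A" and pA: "p = (\<lambda>t. \<Sum>m\<in>A. d m * harmonic m t)"
    unfolding trig_poly_def by blast
  have "0 \<le> (\<Sum>m\<in>A. (cmod (?c m - d m))\<^sup>2)"
    by (intro sum_nonneg) simp
  then have lower: "?I - (\<Sum>m\<in>A. (cmod (?c m))\<^sup>2) < e"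
    using p unfolding pA integral_norm_diff_trig_poly[OF f A] by linarith
  have "dist (\<Sum>m\<in>B. (cmod (?c m))\<^sup>2) ?I < e" if B: "finite B" "A \<subseteq> B" for B
  proof -
    have "0 \<le> (\<integral>t. (cmod (f t - (\<Sum>m\<in>B. ?c m * harmonic m t)))\<^sup>2 \<partial>\<U>)"
      by simp
    then have "(\<Sum>m\<in>B. (cmod (?c m))\<^sup>2) \<le> ?I"
      unfolding integral_norm_diff_trig_poly[OF f B(1)] by simp
    moreover have "(\<Sum>m\<in>A. (cmod (?c m))\<^sup>2) \<le> (\<Sum>m\<in>B. (cmod (?c m))\<^sup>2)"
      using B by (intro sum_mono2) auto
    ultimately show ?thesis
      using lower by (simp add: dist_real_def)
  qed
  then show "\<forall>\<^sub>F B in finite_subsets_at_top UNIV. dist (\<Sum>m\<in>B. (cmod (?c m))\<^sup>2) ?I < e"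
    unfolding eventually_finite_subsets_at_top using A by auto
qed

section \<open>Periodization of a compactly supported function\<close>

lemma finite_int_between: "finite {k::int. a \<le> real_of_int k \<and> real_of_int k < b}"
proof (rule finite_subset)
  show "{k::int. a \<le> real_of_int k \<and> real_of_int k < b} \<subseteq> {\<lceil>a\<rceil>..\<lceil>b\<rceil>}"
    by (auto simp: ceiling_le_iff) linarith
qed simp

text \<open>
  As \<open>\<nu>\<close> runs through \<open>[0, 1)\<close>, the point \<open>k - \<nu>\<close> runs through
  \<open>(k - 1, k]\<close>. The half-open form matters: these intervals tile the line without overlap.
\<close>

lemma integral_unit_reflect:
  fixes F :: "real \<Rightarrow> complex"
  assumes [measurable]: "F \<in> borel_measurable borel"
  shows "(\<integral>\<nu>. F (of_int k - \<nu>) \<partial>\<U>) = (\<integral>t. indicator {of_int k - 1<..of_int k} t *\<^sub>R F t \<partial>lborel)"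
proof -
  have "(\<integral>\<nu>. F (of_int k - \<nu>) \<partial>\<U>) = (\<integral>\<nu>. indicator {0..1} \<nu> *\<^sub>R F (of_int k - \<nu>) \<partial>lborel)"
    by (simp add: integral_restrict_space)
  also have "\<dots> = (\<integral>\<nu>. indicator {0..<1} \<nu> *\<^sub>R F (of_int k - \<nu>) \<partial>lborel)"
  proof (rule integral_cong_AE)
    show "AE \<nu> in lborel. indicator {0..1} \<nu> *\<^sub>R F (of_int k - \<nu>) = indicator {0..<1} \<nu> *\<^sub>R F (of_int k - \<nu>)"
      using AE_lborel_singleton[of "1::real"] by eventually_elim (auto simp: indicator_def)
  qed measurable
  also have "\<dots> = (\<integral>\<nu>. (\<lambda>t. indicator {of_int k - 1<..of_int k} t *\<^sub>R F t) (of_int k + (- 1) * \<nu>) \<partial>lborel)"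
    by (intro Bochner_Integration.integral_cong) (auto simp: indicator_def)
  also have "\<dots> = (\<integral>t. indicator {of_int k - 1<..of_int k} t *\<^sub>R F t \<partial>lborel)"
    using lborel_integral_real_affine[of "- 1" "\<lambda>t. indicator {of_int k - 1<..of_int k} t *\<^sub>R F t" "of_int k"]
    by simp
  finally show ?thesis .
qed

text \<open>
  The index set is exactly large enough: a point \<open>t\<close> of \<open>[-W, W]\<close> lies in the tile with
  \<open>k = \<lceil>t\<rceil>\<close>, and \<open>-W \<le> \<lceil>t\<rceil> < W + 1\<close>.
\<close>

lemma sum_integral_unit_eq_integral:
  fixes F :: "real \<Rightarrow> complex" and W :: real
  assumes F: "bounded_borel F" and supp: "\<And>t. t \<notin> {- W..W} \<Longrightarrow> F t = 0"
  defines "K \<equiv> {k::int. - W \<le> real_of_int k \<and> real_of_int k < W + 1}"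
  shows "(\<Sum>k\<in>K. \<integral>\<nu>. F (of_int k - \<nu>) \<partial>\<U>) = (\<integral>t. F t \<partial>lborel)"
proof -
  obtain B where meas: "F \<in> borel_measurable borel" and B: "\<And>t. norm (F t) \<le> B"
    using F unfolding bounded_borel_def by blast
  have K: "finite K" unfolding K_def by (rule finite_int_between)
  have int: "integrable lborel (\<lambda>t. indicator {of_int k - 1<..of_int k} t *\<^sub>R F t)" for k :: int
  proof (rule integrableI_bounded_set_indicator[where B = B])
    show "AE t in lborel. t \<in> {of_int k - 1<..of_int k} \<longrightarrow> norm (F t) \<le> B"
      by (intro AE_I2 impI B)
    show "F \<in> borel_measurable lborel"
      using meas by simp
  qed simp_all
  have tile: "(\<Sum>k\<in>K. indicator {of_int k - 1<..of_int k} t *\<^sub>R F t) = F t" for t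
  proof (cases "t \<in> {- W..W}")
    case True
    have "- W \<le> of_int \<lceil>t\<rceil>" "of_int \<lceil>t\<rceil> < W + 1"
      using True ceiling_correct[of t] unfolding atLeastAtMost_iff by linarith+
    then have "\<lceil>t\<rceil> \<in> K" by (simp add: K_def)
    moreover have "indicator {of_int k - 1<..of_int k} t *\<^sub>R F t = (if k = \<lceil>t\<rceil> then F t else 0)" for k
    proof -
      have "t \<in> {of_int k - 1<..of_int k} \<longleftrightarrow> k = \<lceil>t\<rceil>"
        using ceiling_eq_iff[of t k] by auto
      then show ?thesis by (simp only: indicator_def) simp
    qed
    ultimately show ?thesis using K by simp
  qed (simp add: supp)
  have "(\<Sum>k\<in>K. \<integral>\<nu>. F (of_int k - \<nu>) \<partial>\<U>)
      = (\<Sum>k\<in>K. \<integral>t. indicator {of_int k - 1<..of_int k} t *\<^sub>R F t \<partial>lborel)"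
    by (simp only: integral_unit_reflect[OF meas])
  also have "\<dots> = (\<integral>t. (\<Sum>k\<in>K. indicator {of_int k - 1<..of_int k} t *\<^sub>R F t) \<partial>lborel)"
    by (rule Bochner_Integration.integral_sum[symmetric]) (rule int)
  also have "\<dots> = (\<integral>t. F t \<partial>lborel)"
    by (simp only: tile)
  finally show ?thesis .
qed

lemma bounded_borel_reflect: "bounded_borel F \<Longrightarrow> bounded_borel (\<lambda>\<nu>. F (a - \<nu>))"
  unfolding bounded_borel_def by auto

text \<open>
  The mechanism of the Poisson summation formula: Fourier coefficients of a periodization are values of
  the Fourier transform. In the reflected variable \<open>k - \<nu>\<close> the conjugate harmonic becomes the
  harmonic itself.
\<close>

lemma fourier_coeff_periodization:
  fixes F :: "real \<Rightarrow> complex" and W :: real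
  assumes F: "bounded_borel F" and supp: "\<And>t. t \<notin> {- W..W} \<Longrightarrow> F t = 0"
  defines "K \<equiv> {k::int. - W \<le> real_of_int k \<and> real_of_int k < W + 1}"
  shows "fourier_coeff (\<lambda>\<nu>. \<Sum>k\<in>K. F (of_int k - \<nu>)) m = (\<integral>t. F t * harmonic m t \<partial>lborel)"
proof -
  have "fourier_coeff (\<lambda>\<nu>. \<Sum>k\<in>K. F (of_int k - \<nu>)) m
      = (\<integral>\<nu>. (\<Sum>k\<in>K. F (of_int k - \<nu>) * harmonic m (of_int k - \<nu>)) \<partial>\<U>)"
    by (simp add: fourier_coeff_def harmonic_diff harmonic_of_int sum_distrib_right)
  also have "\<dots> = (\<Sum>k\<in>K. \<integral>\<nu>. F (of_int k - \<nu>) * harmonic m (of_int k - \<nu>) \<partial>\<U>)"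
    by (intro Bochner_Integration.integral_sum integrable_bounded_borel bounded_borel_mult
        bounded_borel_reflect F bounded_borel_harmonic)
  also have "\<dots> = (\<integral>t. F t * harmonic m t \<partial>lborel)"
    unfolding K_def
    by (rule sum_integral_unit_eq_integral[of "\<lambda>t. F t * harmonic m t"])
       (auto simp: supp intro: bounded_borel_mult F bounded_borel_harmonic)
  finally show ?thesis .
qed

section \<open>Optimal gridding correction\<close>

lemma bounded_borel_gridding_kernel:
  assumes "gridding_kernel W C"
  shows "bounded_borel C"
proof -
  have cont: "continuous_on {- W..W} C" and zero: "\<And>t. t \<notin> {- W..W} \<Longrightarrow> C t = 0"
    using assms unfolding gridding_kernel_def by auto
  have "compact (C ` {- W..W})"
    using cont by (intro compact_continuous_image) auto
  then obtain B where B: "0 < B" "\<forall>z \<in> C ` {- W..W}. norm z \<le> B"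
    using compact_imp_bounded bounded_pos by metis
  have "(\<lambda>t. indicator {- W..W} t *\<^sub>R C t) = C"
    by (auto simp: indicator_def zero)
  then have "C \<in> borel_measurable borel"
    using borel_measurable_continuous_on_indicator[OF _ cont] by auto
  moreover have "norm (C t) \<le> B" for t
    using B zero[of t] by (cases "t \<in> {- W..W}") auto
  ultimately show ?thesis by (rule bounded_borelI)
qed

lemma fourier_conv_cis: "fourier C a = (\<integral>t. C t * cis (- 2 * pi * a * t) \<partial>lborel)"
  by (simp add: fourier_def cis_conv_exp mult_ac)

lemma bounded_borel_cis: "bounded_borel (\<lambda>t. cis (a * t))"
proof (rule bounded_borelI)
  have "continuous_on UNIV (\<lambda>t. exp (\<i> * of_real (a * t)))"
    by (intro continuous_intros)
  then show "(\<lambda>t. cis (a * t)) \<in> borel_measurable borel"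
    unfolding cis_conv_exp by (rule borel_measurable_continuous_onI)
qed (simp, rule order_refl)

text \<open>
  What gridding makes of the exponential of frequency \<open>a = x / \<gamma>\<close>, as a function of the
  offset \<open>\<nu>\<close> and relative to the exponential itself: perfect gridding would give a constant, whose
  inverse is the correction.
\<close>
definition grid_response :: "real \<Rightarrow> (real \<Rightarrow> complex) \<Rightarrow> real \<Rightarrow> real \<Rightarrow> complex" where
  "grid_response W C a \<nu> = (\<Sum>k | - W \<le> real_of_int k \<and> real_of_int k < W + 1.
     C (of_int k - \<nu>) * cis (- 2 * pi * a * (of_int k - \<nu>)))"

lemma bounded_borel_grid_response:
  assumes "gridding_kernel W C"
  shows "bounded_borel (grid_response W C a)"
  unfolding grid_response_def
  by (intro bounded_borel_sum bounded_borel_mult bounded_borel_reflect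
      bounded_borel_gridding_kernel[OF assms] bounded_borel_reflect[OF bounded_borel_cis])

lemma fourier_coeff_grid_response:
  assumes C: "gridding_kernel W C"
  shows "fourier_coeff (grid_response W C a) m = fourier C (a - of_int m)"
proof -
  have "fourier_coeff (grid_response W C a) m = (\<integral>t. (C t * cis (- 2 * pi * a * t)) * harmonic m t \<partial>lborel)"
    unfolding grid_response_def
  proof (rule fourier_coeff_periodization)
    show "bounded_borel (\<lambda>t. C t * cis (- 2 * pi * a * t))"
      by (intro bounded_borel_mult bounded_borel_gridding_kernel[OF C] bounded_borel_cis)
    show "C t * cis (- 2 * pi * a * t) = 0" if "t \<notin> {- W..W}" for t
      using C that unfolding gridding_kernel_def by simp
  qed
  also have "\<dots> = fourier C (a - of_int m)"
    by (simp add: fourier_conv_cis harmonic_def mult.assoc cis_mult) (simp add: algebra_simps)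
  finally show ?thesis .
qed

text \<open>
  By the Parseval identity the alias energy is the mean square of the response. In particular its
  series always converges.
\<close>

lemma has_sum_alias_energy:
  assumes C: "gridding_kernel W C"
  shows "((\<lambda>m::int. (cmod (fourier C (x / \<gamma> + of_int m)))\<^sup>2) has_sum alias_energy \<gamma> C x) UNIV"
    and "alias_energy \<gamma> C x = (\<integral>\<nu>. (cmod (grid_response W C (x / \<gamma>) \<nu>))\<^sup>2 \<partial>\<U>)"
proof -
  let ?E = "\<integral>\<nu>. (cmod (grid_response W C (x / \<gamma>) \<nu>))\<^sup>2 \<partial>\<U>"
  have "((\<lambda>m::int. (cmod (fourier C (x / \<gamma> - of_int m)))\<^sup>2) has_sum ?E) UNIV"
    using parseval[OF bounded_borel_grid_response[OF C]]
    by (simp add: fourier_coeff_grid_response[OF C])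
  \<comment> \<open>The coefficients come with frequency \<open>-m\<close>, the alias energy sums over \<open>+m\<close>.\<close>
  then have *: "((\<lambda>m::int. (cmod (fourier C (x / \<gamma> + of_int m)))\<^sup>2) has_sum ?E) UNIV"
    by (subst has_sum_reindex_bij_betw[of uminus, symmetric]) (auto intro: bij_uminus)
  then show E: "alias_energy \<gamma> C x = ?E"
    unfolding alias_energy_def by (rule infsumI)
  show "((\<lambda>m::int. (cmod (fourier C (x / \<gamma> + of_int m)))\<^sup>2) has_sum alias_energy \<gamma> C x) UNIV"
    unfolding E by (rule *)
qed

text \<open>
  Expanding the square leaves two integrals: the mean of the response, which is its zeroth Fourier
  coefficient, and its mean square, which is the alias energy.
\<close>

lemma gridding_error_eq:
  assumes C: "gridding_kernel W C"
  shows "gridding_error W \<gamma> h C x =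
    1 - 2 * Re (h x * fourier C (x / \<gamma>)) + (cmod (h x))\<^sup>2 * alias_energy \<gamma> C x"
proof -
  let ?g = "grid_response W C (x / \<gamma>)"
  note bb = bounded_borel_grid_response[OF C]
  have "gridding_error W \<gamma> h C x = (\<integral>\<nu>. (cmod (1 - h x * ?g \<nu>))\<^sup>2 \<partial>\<U>)"
    by (simp add: gridding_error_def grid_response_def set_integral_unit_interval cis_conv_exp mult_ac)
  also have "\<dots> = (\<integral>\<nu>. (cmod (1::complex))\<^sup>2 \<partial>\<U>) - 2 * Re (\<integral>\<nu>. 1 * cnj (h x * ?g \<nu>) \<partial>\<U>)
      + (\<integral>\<nu>. (cmod (h x * ?g \<nu>))\<^sup>2 \<partial>\<U>)"
    by (intro integral_norm_diff_sq bounded_borel_const bounded_borel_mult bb)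
  also have "(\<integral>\<nu>. 1 * cnj (h x * ?g \<nu>) \<partial>\<U>) = cnj (h x * fourier_coeff ?g 0)"
    by (simp add: fourier_coeff_def)
  finally show ?thesis
    by (simp add: fourier_coeff_grid_response[OF C] has_sum_alias_energy(2)[OF C]
        norm_mult power_mult_distrib)
qed

text \<open>
  The gridding error is a real quadratic in the single complex number \<open>h x\<close>, so completing the square
  displays its minimum value and its minimizer.
\<close>

lemma gridding_error_complete_square:
  assumes C: "gridding_kernel W C" and E: "alias_energy \<gamma> C x \<noteq> 0"
  shows "gridding_error W \<gamma> h C x =
    opt_error \<gamma> C x + alias_energy \<gamma> C x * (cmod (h x - opt_correction \<gamma> C x))\<^sup>2"
proof -
  have scalar: "1 - 2 * r + s * e = 1 - c / e + e * (s - 2 * r / e + c / e\<^sup>2)"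
    if "e \<noteq> 0" for r s c e :: real
    using that by (simp add: field_simps power2_eq_square)
  let ?E = "alias_energy \<gamma> C x" and ?c = "fourier C (x / \<gamma>)"
  have "(cmod (h x - opt_correction \<gamma> C x))\<^sup>2 =
      (cmod (h x))\<^sup>2 - 2 * Re (h x * ?c) / ?E + (cmod ?c)\<^sup>2 / ?E\<^sup>2"
    by (simp add: cmod_diff_sq opt_correction_def norm_divide power_divide)
  then show ?thesis
    unfolding gridding_error_eq[OF C] opt_error_def
    by (simp only: scalar[OF E])
qed

theorem theorem2p2p2:
  fixes W \<gamma> x :: real and C :: "real \<Rightarrow> complex"
  assumes "W \<ge> 1" and "\<gamma> \<ge> 1"
    and "gridding_kernel W C"
    and "x \<in> {-1/2..<1/2}"
    and "alias_energy \<gamma> C x \<noteq> 0"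
  shows "opt_error \<gamma> C x =
           (\<Sum>\<^sub>\<infinity>m\<in>UNIV - {0::int}. (cmod (fourier C (x / \<gamma> + real_of_int m)))\<^sup>2) / alias_energy \<gamma> C x
       \<and> (\<forall>h :: real \<Rightarrow> complex. opt_error \<gamma> C x \<le> gridding_error W \<gamma> h C x)
       \<and> (\<forall>h :: real \<Rightarrow> complex. h x = opt_correction \<gamma> C x
             \<longrightarrow> gridding_error W \<gamma> h C x = opt_error \<gamma> C x)"
proof (intro conjI allI impI)
  let ?E = "alias_energy \<gamma> C x" and ?f = "\<lambda>m::int. (cmod (fourier C (x / \<gamma> + real_of_int m)))\<^sup>2"
  note C = \<open>gridding_kernel W C\<close> and E = \<open>?E \<noteq> 0\<close>
  have summable: "?f summable_on UNIV"
    using has_sum_alias_energy(1)[OF C] by (rule has_sum_imp_summable)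
  have "?f summable_on UNIV - {0}"
    using summable by (rule summable_on_subset_banach) simp
  then have "infsum ?f (insert 0 (UNIV - {0})) = ?f 0 + infsum ?f (UNIV - {0})"
    by (rule infsum_insert) simp
  then have "?E = (cmod (fourier C (x / \<gamma>)))\<^sup>2 + infsum ?f (UNIV - {0})"
    by (simp add: alias_energy_def insert_absorb)
  then show "opt_error \<gamma> C x = infsum ?f (UNIV - {0}) / ?E"
    using E by (simp add: opt_error_def field_simps)
  have "0 \<le> ?E"
    unfolding alias_energy_def by (intro infsum_nonneg) simp
  then show "opt_error \<gamma> C x \<le> gridding_error W \<gamma> h C x" for h
    unfolding gridding_error_complete_square[OF C E] by simp
  show "gridding_error W \<gamma> h C x = opt_error \<gamma> C x" if "h x = opt_correction \<gamma> C x" for h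
    unfolding gridding_error_complete_square[OF C E] using that by simp
qed

end
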